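(* Consider any circuit $G\in\mathcal{GC}_{ad}$ and the corresponding set of nonadaptive circuits $G(g)$ (one for each guess string $g$), which together make up the set $\mathcal{GC}_{nad}$. Any circuit in $\mathcal{GC}_{nad}$ has depth at most four, using one- and two-qubit gates and starting with the state $|00\ldots0\rangle$.
   Context: **Circuits.** A quantum gate is an element of $SU(2)$ acting on one qubit or of $SU(4)$ acting on two qubits (tensored with the identity on the other qubits). A quantum circuit $QC_x(w,w',|init\rangle,d)$, determined by a bit string $x$, of width $w$, depth $d$ and classical output width $w'\le w$, consists of a $w$-qubit register initially in state $|init\rangle$; in each time step $1,\dots,d-1$ the register is acted on by one- and two-qubit gates (in parallel on disjoint sets of qubits); time step $d$ is a measurement in the computational basis of some $w'$ of the qubits. The output is the $w'$-bit outcome string together with the post-measurement state of the $w-w'$ unmeasured qubits. Circuits can be composed (written $*$) by feeding the unmeasured qubits of one circuit into the next. Depth four thus means three layers of gates followed by a measurement layer. **Adaptive circuits.** $\mathcal{QC}_{ad}$ consists of all composed circuits $QC_{x,b_1,\dots,b_R}(|\psi_{b_R}\rangle,d_{R+1})*\cdots*QC_{x,b_1}(|\psi_{b_1}\rangle,d_2)*QC_x(|init\rangle,d_1)$, where $b_i$ is the measurement outcome of the $i$-th circuit, $|\psi_{b_i}\rangle$ is the state of the unmeasured qubits, and the description of each circuit is an efficiently computable function of $x$ and the previous outcomes; the number of rounds, the depths and the widths are polynomial in $|x|$. **Nonadaptive circuits.** For $QC_{ad}\in\mathcal{QC}_{ad}$ and a guess bit string $g=(g_1,\dots,g_R)$,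 $QC_{nad}(g)$ is the same composition with the dependence of the circuit descriptions on $b_1,b_2,\dots$ replaced by dependence on $g_1,g_2,\dots$. Since no gate depends on measured outcomes, all measurements can be moved to the end and $QC_{nad}(g)$ is viewed as a single ordinary quantum circuit. **Bell measurement.** With $|\Phi^\pm\rangle=\frac1{\sqrt2}(|00\rangle\pm|11\rangle)$ and $|\Psi^\pm\rangle=\frac1{\sqrt2}(|01\rangle\pm|10\rangle)$, a Bell measurement on two qubits is the two-qubit unitary $|00\rangle\langle\Psi^+|+|01\rangle\langle\Psi^-|+|10\rangle\langle\Phi^+|+|11\rangle\langle\Phi^-|$ followed by a computational-basis measurement of both qubits. **Gottesman-Chuang circuits.** $|\Psi_C\rangle$ is the four-qubit state (qubits labelled 1,2,3,4) obtained by preparing qubits 1,2 in $|\Phi^+\rangle$ and qubits 3,4 in $|\Phi^+\rangle$ (each from $|00\rangle$; this can be done by one two-qubit gate per pair) and then applying a CNOT to qubits 2 (control) and 3 (target). A circuit $G\in\mathcal{QC}_{ad}$ belongs to $\mathcal{GC}_{ad}$ when: (1) all the quantum circuits composing $G$ contain only one-qubit gates; (2) $|init\rangle$ consists of some qubits in state $|0\rangle$ and others in four-qubit states $|\Psi_C\rangle$; (3) each intermediate measurement consists of two Bell measurements, the first on qubit 1 of a new $|\Psi_C\rangle$ that has not been acted upon previously and some other arbitrary qubit in the circuit, the second on qubit 4 of the same $|\Psi_C\rangle$ and some other arbitrary qubit. These circuits arise from ordinary circuits over CNOT and one-qubit gates by replacing each CNOT by gate teleportation: the two input qubits are Bell-measured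 with qubits 1 and 4 of a $|\Psi_C\rangle$, after which qubits 2 and 3 carry the output, up to one-qubit correction gates determined by the outcomes. For $G\in\mathcal{GC}_{ad}$, $G(g)$ is the corresponding nonadaptive circuit, regarded as starting from $|0\cdots0\rangle$ and including the preparation of the states $|\Psi_C\rangle$. *)

theory Defs
  imports "HOL-Analysis.Analysis" "HOL-Computational_Algebra.Polynomial"
begin

section \<open>Gates and states\<close>

text \<open>
  One- and two-qubit gates are matrices indexed by the computational basis, that is, by
  \<^typ>\<open>bool\<close> and \<^typ>\<open>bool \<times> bool\<close> (\<^term>\<open>False\<close> is 0 and \<^term>\<open>True\<close> is 1).
\<close>

type_synonym gate1 = "complex ^ bool ^ bool"
type_synonym vec2 = "complex ^ (bool \<times> bool)"
type_synonym gate2 = "complex ^ (bool \<times> bool) ^ (bool \<times> bool)"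

definition SU :: "(complex ^ 'n ^ 'n) set" where
  "SU = {U. U ** map_matrix cnj (transpose U) = mat 1 \<and> det U = 1}"

text \<open>
  A basis state assigns a bit to every qubit label; labels outside the register carry the
  bit 0.  A state vector is its function of amplitudes.
\<close>

type_synonym basis_state = "nat \<Rightarrow> bool"
type_synonym state = "basis_state \<Rightarrow> complex"

definition basis :: "nat \<Rightarrow> basis_state set" where
  "basis n = {x. \<forall>q. x q \<longrightarrow> q < n}"

definition is_state :: "nat \<Rightarrow> state \<Rightarrow> bool" where
  "is_state n \<psi> \<longleftrightarrow> (\<forall>x. x \<notin> basis n \<longrightarrow> \<psi> x = 0) \<and> (\<Sum>x\<in>basis n. (cmod (\<psi> x))\<^sup>2) = 1"

definition zero_state :: state where
  "zero_state x = (if x = (\<lambda>_. False) then 1 else 0)"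

datatype gate = One gate1 nat | Two gate2 nat nat

fun gate_qubits :: "gate \<Rightarrow> nat list" where
  "gate_qubits (One U q) = [q]"
| "gate_qubits (Two U p q) = [p, q]"

fun gate_ok :: "gate \<Rightarrow> bool" where
  "gate_ok (One U q) \<longleftrightarrow> U \<in> SU"
| "gate_ok (Two U p q) \<longleftrightarrow> U \<in> SU \<and> p \<noteq> q"

fun is_One :: "gate \<Rightarrow> bool" where
  "is_One (One U q) \<longleftrightarrow> True"
| "is_One (Two U p q) \<longleftrightarrow> False"

fun apply_gate :: "gate \<Rightarrow> state \<Rightarrow> state" where
  "apply_gate (One U q) \<psi> = (\<lambda>x. \<Sum>b\<in>UNIV. U $ x q $ b * \<psi> (x(q := b)))"
| "apply_gate (Two U p q) \<psi> =
     (\<lambda>x. \<Sum>(b, c)\<in>UNIV. U $ (x p, x q) $ (b, c) * \<psi> (x(p := b, q := c)))"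


section \<open>Circuits\<close>

text \<open>
  A stage is a circuit without its initial state: layers of gates, one per time step,
  followed by one time step in which the qubits in \<open>meas\<close> are measured.  Qubits keep their
  labels when stages are composed.
\<close>

record stage =
  layers :: "gate list list"
  meas :: "nat list"

record circuit = stage +
  width :: nat
  init :: state

definition depth :: "'a stage_scheme \<Rightarrow> nat" where
  "depth C = Suc (length (layers C))"

definition layers_qubits :: "gate list list \<Rightarrow> nat set" where
  "layers_qubits Ls = (\<Union>L\<in>set Ls. \<Union>h\<in>set L. set (gate_qubits h))"

definition wf_stage :: "nat set \<Rightarrow> 'a stage_scheme \<Rightarrow> bool" where
  "wf_stage Q C \<longleftrightarrow>
     (\<forall>L\<in>set (layers C). (\<forall>h\<in>set L. gate_ok h) \<and> distinct (concat (map gate_qubits L))) \<and>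
     layers_qubits (layers C) \<subseteq> Q \<and>
     distinct (meas C) \<and> set (meas C) \<subseteq> Q"

definition wf_circuit :: "circuit \<Rightarrow> bool" where
  "wf_circuit C \<longleftrightarrow> is_state (width C) (init C) \<and> wf_stage {..<width C} C"

definition premeasurement :: "circuit \<Rightarrow> state" where
  "premeasurement C = fold (fold apply_gate) (layers C) (init C)"

text \<open>
  The unnormalised state of the unmeasured qubits when measuring \<open>ms\<close> gives the string \<open>b\<close>.
  Measured qubits have left the register, so they carry the bit 0 in its basis states.
\<close>

definition residual :: "nat list \<Rightarrow> bool list \<Rightarrow> state \<Rightarrow> state" where
  "residual ms b \<psi> =
     (\<lambda>x. if \<exists>q\<in>set ms. x q then 0 else \<psi> (fold (\<lambda>(q, v) y. y(q := v)) (zip ms b) x))"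

definition outcome_prob :: "circuit \<Rightarrow> bool list \<Rightarrow> real" where
  "outcome_prob C b =
     (\<Sum>x\<in>basis (width C). (cmod (residual (meas C) b (premeasurement C) x))\<^sup>2)"

definition post_state :: "circuit \<Rightarrow> bool list \<Rightarrow> state" where
  "post_state C b =
     (\<lambda>x. residual (meas C) b (premeasurement C) x / of_real (sqrt (outcome_prob C b)))"

text \<open>
  State vectors that differ by a phase are the same physical state.
\<close>

definition same_output :: "circuit \<Rightarrow> circuit \<Rightarrow> bool" where
  "same_output C D \<longleftrightarrow>
     width C = width D \<and> meas C = meas D \<and>
     (\<forall>b. length b = length (meas C) \<longrightarrow>
        outcome_prob C b = outcome_prob D b \<and>
        (outcome_prob C b \<noteq> 0 \<longrightarrow>
           (\<exists>c. cmod c = 1 \<and> post_state C b = (\<lambda>x. c * post_state D b x))))"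


section \<open>Efficient computability\<close>

text \<open>
  Deterministic one-tape Turing machines.  The program is a finite table sending a state and a
  scanned symbol to a new state, a written symbol and a head movement (the sign of the last
  component); the machine halts when the table has no entry.  Symbol 0 is the blank, 1 and 2
  are the bits.
\<close>

type_synonym tm = "((nat \<times> nat) \<times> (nat \<times> nat \<times> int)) list"
type_synonym config = "nat \<times> int \<times> (int \<Rightarrow> nat)"

definition tm_step :: "tm \<Rightarrow> config \<Rightarrow> config option" where
  "tm_step M = (\<lambda>(q, h, t).
     map_option (\<lambda>(q', s, d). (q', h + sgn d, t(h := s))) (map_of M (q, t h)))"

definition tape_of :: "bool list \<Rightarrow> int \<Rightarrow> nat" where
  "tape_of w = (\<lambda>i. if 0 \<le> i \<and> nat i < length w then (if w ! nat i then 2 else 1) else 0)"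

definition tm_outputs_within :: "tm \<Rightarrow> bool list \<Rightarrow> bool list \<Rightarrow> nat \<Rightarrow> bool" where
  "tm_outputs_within M w v T \<longleftrightarrow>
     (\<exists>m\<le>T. \<exists>q h. ((0, 0, tape_of w), (q, h, tape_of v)) \<in> {(c, c'). tm_step M c = Some c'} ^^ m \<and>
        tm_step M (q, h, tape_of v) = None)"

definition polytime :: "(bool list \<Rightarrow> bool list) \<Rightarrow> bool" where
  "polytime F \<longleftrightarrow>
     (\<exists>M. \<exists>p :: nat poly. \<forall>w. tm_outputs_within M w (F w) (poly p (length w)))"

text \<open>A self-delimiting encoding of lists of bit strings as bit strings.\<close>

definition enc :: "bool list list \<Rightarrow> bool list" where
  "enc ss = concat (map (\<lambda>s. concat (map (\<lambda>b. [True, b]) s) @ [False, False]) ss)"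

text \<open>Sign bit followed by the binary digits, least significant first.\<close>

fun int_of_bits :: "bool list \<Rightarrow> int" where
  "int_of_bits [] = 0"
| "int_of_bits (b # bs) = (if b then -1 else 1) * horner_sum of_bool 2 bs"

text \<open>
  Gates have complex entries, so a description of a stage is a list of real numbers, and it is
  computed to any desired precision.
\<close>

fun gate_data :: "gate \<Rightarrow> real list" where
  "gate_data (One U q) = [1, real q] @
     concat [[Re (U $ i $ j), Im (U $ i $ j)]. i \<leftarrow> [False, True], j \<leftarrow> [False, True]]"
| "gate_data (Two U p q) = [2, real p, real q] @
     concat [[Re (U $ i $ j), Im (U $ i $ j)].
       i \<leftarrow> List.product [False, True] [False, True], j \<leftarrow> List.product [False, True] [False, True]]"

definition stage_data :: "nat \<Rightarrow> stage \<Rightarrow> real list" where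
  "stage_data w C =
     [real w, real (length (layers C))] @
     concat (map (\<lambda>L. real (length L) # concat (map gate_data L)) (layers C)) @
     [real (length (meas C))] @ map real (meas C)"

text \<open>
  The output \<open>v\<close> gives every entry of \<open>rs\<close> within an error of \<open>1 / 2 ^ k\<close>, as a list of
  integers over the common denominator \<open>2 ^ k\<close>.
\<close>

definition approximates :: "nat \<Rightarrow> bool list \<Rightarrow> real list \<Rightarrow> bool" where
  "approximates k v rs \<longleftrightarrow>
     (\<exists>ss. v = enc ss \<and>
        list_all2 (\<lambda>s r. \<bar>real_of_int (int_of_bits s) / 2 ^ k - r\<bar> \<le> 1 / 2 ^ k) ss rs)"


section \<open>Adaptive and nonadaptive circuits\<close>

text \<open>
  \<open>stage_at G x [b\<^sub>1, \<dots>, b\<^sub>i]\<close> is the circuit number \<open>i + 1\<close> of the composition; there are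
  \<open>rounds G x + 1\<close> of them.
\<close>

record adaptive =
  awidth :: "bool list \<Rightarrow> nat"
  ainit :: "bool list \<Rightarrow> state"
  rounds :: "bool list \<Rightarrow> nat"
  stage_at :: "bool list \<Rightarrow> bool list list \<Rightarrow> stage"

definition history :: "adaptive \<Rightarrow> bool list \<Rightarrow> bool list list \<Rightarrow> bool" where
  "history G x bs \<longleftrightarrow>
     length bs \<le> rounds G x \<and>
     (\<forall>i<length bs. length (bs ! i) = length (meas (stage_at G x (take i bs))))"

definition unmeasured :: "adaptive \<Rightarrow> bool list \<Rightarrow> bool list list \<Rightarrow> nat set" where
  "unmeasured G x bs =
     {..<awidth G x} - (\<Union>i<length bs. set (meas (stage_at G x (take i bs))))"

definition QC_ad :: "adaptive set" where
  "QC_ad = {G.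
     (\<forall>x. is_state (awidth G x) (ainit G x)) \<and>
     (\<forall>x bs. history G x bs \<longrightarrow> wf_stage (unmeasured G x bs) (stage_at G x bs)) \<and>
     (\<exists>F. polytime F \<and>
        (\<forall>x bs k. history G x bs \<longrightarrow>
           approximates k (F (enc (x # bs @ [replicate k True])))
             (stage_data (card (unmeasured G x bs)) (stage_at G x bs)))) \<and>
     (\<exists>p :: nat poly. \<forall>x.
        awidth G x \<le> poly p (length x) \<and>
        rounds G x \<le> poly p (length x) \<and>
        (\<forall>bs. history G x bs \<longrightarrow> depth (stage_at G x bs) \<le> poly p (length x)))}"

definition guess :: "adaptive \<Rightarrow> bool list \<Rightarrow> bool list list \<Rightarrow> bool" where
  "guess G x g \<longleftrightarrow> history G x g \<and> length g = rounds G x"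

text \<open>The stages selected by the guess, with all measurements moved to the end.\<close>

definition QC_nad :: "adaptive \<Rightarrow> bool list \<Rightarrow> bool list list \<Rightarrow> circuit" where
  "QC_nad G x g =
     (let Cs = map (\<lambda>i. stage_at G x (take i g)) [0..<Suc (rounds G x)]
      in \<lparr>layers = concat (map layers Cs), meas = concat (map meas Cs),
          width = awidth G x, init = ainit G x\<rparr>)"


section \<open>Bell measurements and Gottesman-Chuang circuits\<close>

definition ket :: "bool \<Rightarrow> bool \<Rightarrow> vec2" where
  "ket a b = axis (a, b) 1"

definition outer :: "vec2 \<Rightarrow> vec2 \<Rightarrow> gate2" where
  "outer u v = (\<chi> i j. u $ i * cnj (v $ j))"

definition Phi_plus :: vec2 where
  "Phi_plus = (1 / sqrt 2) *\<^sub>R (ket False False + ket True True)"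
definition Phi_minus :: vec2 where
  "Phi_minus = (1 / sqrt 2) *\<^sub>R (ket False False - ket True True)"
definition Psi_plus :: vec2 where
  "Psi_plus = (1 / sqrt 2) *\<^sub>R (ket False True + ket True False)"
definition Psi_minus :: vec2 where
  "Psi_minus = (1 / sqrt 2) *\<^sub>R (ket False True - ket True False)"

definition bell_unitary :: gate2 where
  "bell_unitary =
     outer (ket False False) Psi_plus + outer (ket False True) Psi_minus +
     outer (ket True False) Phi_plus + outer (ket True True) Phi_minus"

definition CNOT :: gate2 where
  "CNOT = (\<chi> i j. if i = (fst j, snd j \<noteq> fst j) then 1 else 0)"

definition Psi_C :: "bool \<Rightarrow> bool \<Rightarrow> bool \<Rightarrow> bool \<Rightarrow> complex" where
  "Psi_C a b c d =
     (\<Sum>(b', c')\<in>UNIV. CNOT $ (b, c) $ (b', c') * (Phi_plus $ (a, b') * Phi_plus $ (c', d)))"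

text \<open>A block lists the labels of qubits 1, 2, 3, 4 of a copy of \<^term>\<open>Psi_C\<close>.\<close>

type_synonym block = "nat \<times> nat \<times> nat \<times> nat"

fun block_qubits :: "block \<Rightarrow> nat list" where
  "block_qubits (q1, q2, q3, q4) = [q1, q2, q3, q4]"

definition blocks_state :: "block list \<Rightarrow> state" where
  "blocks_state Bs x =
     (if \<forall>q. x q \<longrightarrow> q \<in> set (concat (map block_qubits Bs))
      then \<Prod>(q1, q2, q3, q4)\<leftarrow>Bs. Psi_C (x q1) (x q2) (x q3) (x q4) else 0)"

definition touched :: "adaptive \<Rightarrow> bool list \<Rightarrow> bool list list \<Rightarrow> nat set" where
  "touched G x bs = (\<Union>i<length bs. let C = stage_at G x (take i bs)
                                    in layers_qubits (layers C) \<union> set (meas C))"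

text \<open>
  A stage that ends with two Bell measurements: its last layer of gates is the unitary part of
  the Bell measurements, the layers in \<open>Ls\<close> before it consist of one-qubit gates.  The two
  qubits of a Bell measurement are allowed in either order.
\<close>

definition bell_stage :: "adaptive \<Rightarrow> block list \<Rightarrow> bool list \<Rightarrow> bool list list \<Rightarrow> bool" where
  "bell_stage G Bs x bs \<longleftrightarrow>
     (\<exists>Ls p p' r r' q1 q2 q3 q4 a b.
        layers (stage_at G x bs) = Ls @ [[Two bell_unitary p p', Two bell_unitary r r']] \<and>
        meas (stage_at G x bs) = [p, p', r, r'] \<and>
        (\<forall>L\<in>set Ls. \<forall>h\<in>set L. is_One h) \<and>
        (q1, q2, q3, q4) \<in> set Bs \<and>
        {q1, q2, q3, q4} \<inter> (touched G x bs \<union> layers_qubits Ls) = {} \<and>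
        (p, p') \<in> {(q1, a), (a, q1)} \<and> (r, r') \<in> {(q4, b), (b, q4)})"

definition GC_blocks :: "adaptive \<Rightarrow> (bool list \<Rightarrow> block list) \<Rightarrow> bool" where
  "GC_blocks G B \<longleftrightarrow>
     (\<forall>x. distinct (concat (map block_qubits (B x))) \<and>
          set (concat (map block_qubits (B x))) \<subseteq> {..<awidth G x} \<and>
          ainit G x = blocks_state (B x)) \<and>
     (\<forall>x bs. history G x bs \<and> length bs < rounds G x \<longrightarrow> bell_stage G (B x) x bs) \<and>
     (\<forall>x bs. history G x bs \<and> length bs = rounds G x \<longrightarrow>
        (\<forall>L\<in>set (layers (stage_at G x bs)). \<forall>h\<in>set L. is_One h))"

definition GC_ad :: "adaptive set" where
  "GC_ad = {G \<in> QC_ad. \<exists>B. GC_blocks G B}"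

text \<open>
  Preparation of the blocks from the zero state.  The first gate is an element of SU(4) that
  sends the basis state 00 to \<^term>\<open>Phi_plus\<close>; the phase puts \<^term>\<open>CNOT\<close>, which has
  determinant -1, into SU(4).
\<close>

definition prep_Phi_plus :: gate2 where
  "prep_Phi_plus =
     outer Phi_plus (ket False False) + outer Psi_plus (ket False True) -
     outer Psi_minus (ket True False) - outer Phi_minus (ket True True)"

definition CNOT_SU :: gate2 where
  "CNOT_SU = (\<chi> i j. cis (pi / 4) * CNOT $ i $ j)"

definition prep_layers :: "block list \<Rightarrow> gate list list" where
  "prep_layers Bs =
     [concat (map (\<lambda>(q1, q2, q3, q4). [Two prep_Phi_plus q1 q2, Two prep_Phi_plus q3 q4]) Bs),
      map (\<lambda>(q1, q2, q3, q4). Two CNOT_SU q2 q3) Bs]"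

definition GC_nad_circuit ::
  "adaptive \<Rightarrow> (bool list \<Rightarrow> block list) \<Rightarrow> bool list \<Rightarrow> bool list list \<Rightarrow> circuit" where
  "GC_nad_circuit G B x g =
     (QC_nad G x g)\<lparr>layers := prep_layers (B x) @ layers (QC_nad G x g), init := zero_state\<rparr>"

definition GC_nad_of :: "adaptive \<Rightarrow> circuit set" where
  "GC_nad_of G = {GC_nad_circuit G B x g | B x g. GC_blocks G B \<and> guess G x g}"

definition GC_nad :: "circuit set" where
  "GC_nad = (\<Union>G\<in>GC_ad. GC_nad_of G)"

text \<open>
  The depth of a circuit as it is written down can be reduced by merging gates and by performing
  gates on disjoint qubits in parallel; a circuit has depth at most \<open>d\<close> when some circuit with
  the same initial state and the same output has at most \<open>d\<close> time steps.
\<close>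

definition has_depth_at_most :: "nat \<Rightarrow> circuit \<Rightarrow> bool" where
  "has_depth_at_most d N \<longleftrightarrow>
     (\<exists>C. wf_circuit C \<and> init C = init N \<and> depth C \<le> d \<and> same_output C N)"

end

(*
The two preparation layers are kept; everything after them collapses into a single layer. A
measured qubit leaves the register, so the two-qubit unitary of a Bell measurement is the last
gate on each of its two qubits. Every one-qubit gate can therefore be moved forward past gates on
other qubits until it is absorbed into the next gate on its own qubit, which leaves one gate for
each Bell-measured pair and one for each other qubit: three layers and a measurement.
*)
theory Submission
  imports Defs
begin

section \<open>Determinants of matrices indexed by one or two bits\<close>

lemma UNIV_bool_pair: "(UNIV :: (bool \<times> bool) set) = {(False, False), (False, True), (True, False), (True, True)}"
  by auto

lemma sum_bool_pair: "(\<Sum>i\<in>UNIV. f i) = f (False, False) + f (False, True) + f (True, False) + f (True, True)"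
  for f :: "bool \<times> bool \<Rightarrow> 'a::comm_monoid_add"
  by (simp add: UNIV_bool_pair add.assoc)

lemma det_bool: "det A = A $ False $ False * A $ True $ True - A $ False $ True * A $ True $ False"
  for A :: "'a::comm_ring_1 ^ bool ^ bool"
proof -
  have f: "finite {True}" "False \<notin> {True}" by auto
  show ?thesis
    unfolding det_def UNIV_bool
    unfolding sum_over_permutations_insert[OF f] permutes_sing
    by (simp add: sign_swap_id sign_id swap_id_eq)
qed

text \<open>The Leibniz sum is unrolled one index at a time, a permutation of an enlarged index set
  being a swap after a permutation of the smaller set. The explicit polynomial makes determinants of
  gates computable.\<close>

lemma det_bool_pair:
  "det A =
    A$(False, False)$(False, False) * A$(False, True)$(False, True) * A$(True, False)$(True, False) * A$(True, True)$(True, True) +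
    A$(False, False)$(False, False) * A$(False, True)$(True, False) * A$(True, False)$(True, True) * A$(True, True)$(False, True) +
    A$(False, False)$(False, False) * A$(False, True)$(True, True) * A$(True, False)$(False, True) * A$(True, True)$(True, False) +
    A$(False, False)$(False, True) * A$(False, True)$(False, False) * A$(True, False)$(True, True) * A$(True, True)$(True, False) +
    A$(False, False)$(False, True) * A$(False, True)$(True, False) * A$(True, False)$(False, False) * A$(True, True)$(True, True) +
    A$(False, False)$(False, True) * A$(False, True)$(True, True) * A$(True, False)$(True, False) * A$(True, True)$(False, False) +
    A$(False, False)$(True, False) * A$(False, True)$(False, False) * A$(True, False)$(False, True) * A$(True, True)$(True, True) +
    A$(False, False)$(True, False) * A$(False, True)$(False, True) * A$(True, False)$(True, True) * A$(True, True)$(False, False) +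
    A$(False, False)$(True, False) * A$(False, True)$(True, True) * A$(True, False)$(False, False) * A$(True, True)$(False, True) +
    A$(False, False)$(True, True) * A$(False, True)$(False, False) * A$(True, False)$(True, False) * A$(True, True)$(False, True) +
    A$(False, False)$(True, True) * A$(False, True)$(False, True) * A$(True, False)$(False, False) * A$(True, True)$(True, False) +
    A$(False, False)$(True, True) * A$(False, True)$(True, False) * A$(True, False)$(False, True) * A$(True, True)$(False, False) -
    A$(False, False)$(False, False) * A$(False, True)$(False, True) * A$(True, False)$(True, True) * A$(True, True)$(True, False) -
    A$(False, False)$(False, False) * A$(False, True)$(True, False) * A$(True, False)$(False, True) * A$(True, True)$(True, True) -
    A$(False, False)$(False, False) * A$(False, True)$(True, True) * A$(True, False)$(True, False) * A$(True, True)$(False, True) -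
    A$(False, False)$(False, True) * A$(False, True)$(False, False) * A$(True, False)$(True, False) * A$(True, True)$(True, True) -
    A$(False, False)$(False, True) * A$(False, True)$(True, False) * A$(True, False)$(True, True) * A$(True, True)$(False, False) -
    A$(False, False)$(False, True) * A$(False, True)$(True, True) * A$(True, False)$(False, False) * A$(True, True)$(True, False) -
    A$(False, False)$(True, False) * A$(False, True)$(False, False) * A$(True, False)$(True, True) * A$(True, True)$(False, True) -
    A$(False, False)$(True, False) * A$(False, True)$(False, True) * A$(True, False)$(False, False) * A$(True, True)$(True, True) -
    A$(False, False)$(True, False) * A$(False, True)$(True, True) * A$(True, False)$(False, True) * A$(True, True)$(False, False) -
    A$(False, False)$(True, True) * A$(False, True)$(False, False) * A$(True, False)$(False, True) * A$(True, True)$(True, False) -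
    A$(False, False)$(True, True) * A$(False, True)$(False, True) * A$(True, False)$(True, False) * A$(True, True)$(False, False) -
    A$(False, False)$(True, True) * A$(False, True)$(True, False) * A$(True, False)$(False, False) * A$(True, True)$(False, True)"
  for A :: "'a::comm_ring_1 ^ (bool \<times> bool) ^ (bool \<times> bool)"
proof -
  have f1: "finite {(False, True), (True, False), (True, True)}"
    "(False, False) \<notin> {(False, True), (True, False), (True, True)}" by auto
  have f2: "finite {(True, False), (True, True)}"
    "(False, True) \<notin> {(True, False), (True, True)}" by auto
  have f3: "finite {(True, True)}" "(True, False) \<notin> {(True, True)}" by auto
  show ?thesis
    unfolding det_def UNIV_bool_pair
    unfolding sum_over_permutations_insert[OF f1]
    unfolding sum_over_permutations_insert[OF f2]
    unfolding sum_over_permutations_insert[OF f3]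
    unfolding permutes_sing
    by (simp add: sign_swap_id permutation_swap_id permutation_compose sign_compose sign_id swap_id_eq)
qed

section \<open>Products of gates as matrices\<close>

text \<open>The Kronecker product of \<open>U\<close> with the identity on the second qubit, the
  form in which a one-qubit gate is multiplied into a two-qubit gate; \<open>on_snd\<close> is its
  mirror image.\<close>

definition on_fst :: "gate1 \<Rightarrow> gate2" where
  "on_fst U = (\<chi> i j. if snd i = snd j then U $ fst i $ fst j else 0)"

definition on_snd :: "gate1 \<Rightarrow> gate2" where
  "on_snd U = (\<chi> i j. if fst i = fst j then U $ snd i $ snd j else 0)"

lemma on_fst_mult: "on_fst U ** on_fst V = on_fst (U ** V)"
  by (simp add: on_fst_def vec_eq_iff matrix_matrix_mult_def sum_bool_pair UNIV_bool)

lemma on_snd_mult: "on_snd U ** on_snd V = on_snd (U ** V)"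
  by (simp add: on_snd_def vec_eq_iff matrix_matrix_mult_def sum_bool_pair UNIV_bool)

lemma on_fst_one: "on_fst (mat 1) = mat 1" and on_snd_one: "on_snd (mat 1) = mat 1"
  by (auto simp: on_fst_def on_snd_def vec_eq_iff mat_def)

lemma on_fst_adjoint: "map_matrix cnj (transpose (on_fst U)) = on_fst (map_matrix cnj (transpose U))"
  and on_snd_adjoint: "map_matrix cnj (transpose (on_snd U)) = on_snd (map_matrix cnj (transpose U))"
  by (auto simp: on_fst_def on_snd_def vec_eq_iff map_matrix_def transpose_def)

lemma SU_mult: "A \<in> SU \<Longrightarrow> B \<in> SU \<Longrightarrow> A ** B \<in> SU"
proof -
  assume "A \<in> SU" "B \<in> SU"
  then have A: "A ** map_matrix cnj (transpose A) = mat 1" "det A = 1"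
    and B: "B ** map_matrix cnj (transpose B) = mat 1" "det B = 1"
    by (auto simp: SU_def)
  have adj: "map_matrix cnj (transpose (A ** B)) = map_matrix cnj (transpose B) ** map_matrix cnj (transpose A)"
    by (simp add: vec_eq_iff map_matrix_def transpose_def matrix_matrix_mult_def mult.commute)
  have "A ** B ** (map_matrix cnj (transpose B) ** map_matrix cnj (transpose A)) = mat 1"
    by (metis A(1) B(1) matrix_mul_assoc matrix_mul_rid)
  then show ?thesis
    using A B by (simp add: SU_def adj det_mul)
qed

lemma apply_gate_One_One:
  "apply_gate (One U q) (apply_gate (One V q) \<psi>) = apply_gate (One (U ** V) q) \<psi>"
  by (rule ext) (simp add: matrix_matrix_mult_def UNIV_bool algebra_simps)

lemma apply_gate_Two_One_fst:
  "p \<noteq> q \<Longrightarrow> apply_gate (Two U p q) (apply_gate (One V p) \<psi>) = apply_gate (Two (U ** on_fst V) p q) \<psi>"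
  by (rule ext) (simp add: on_fst_def matrix_matrix_mult_def sum_bool_pair UNIV_bool fun_upd_twist algebra_simps)

lemma apply_gate_Two_One_snd:
  "p \<noteq> q \<Longrightarrow> apply_gate (Two U p q) (apply_gate (One V q) \<psi>) = apply_gate (Two (U ** on_snd V) p q) \<psi>"
  by (rule ext) (simp add: on_snd_def matrix_matrix_mult_def sum_bool_pair UNIV_bool fun_upd_twist algebra_simps)

text \<open>Neither gate reads or writes a bit of the other, so the two finite sums can be
  interchanged.\<close>

lemma apply_gate_commute:
  "q \<notin> set (gate_qubits h) \<Longrightarrow> apply_gate h (apply_gate (One V q) \<psi>) = apply_gate (One V q) (apply_gate h \<psi>)"
proof (cases h)
  case (One U p)
  assume "q \<notin> set (gate_qubits h)"
  then show ?thesis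
    by (intro ext) (simp add: One UNIV_bool fun_upd_twist algebra_simps)
next
  case (Two U p r)
  assume "q \<notin> set (gate_qubits h)"
  then show ?thesis
    by (intro ext) (simp add: Two sum_bool_pair UNIV_bool fun_upd_twist algebra_simps)
qed

text \<open>Up to the order of the basis, \<open>on_fst U\<close> is block diagonal with two copies
  of \<open>U\<close>, which squares the determinant.\<close>

lemma on_fst_SU: "U \<in> SU \<Longrightarrow> on_fst U \<in> SU"
proof -
  assume U: "U \<in> SU"
  have "det (on_fst U) = det U ^ 2"
    unfolding det_bool_pair det_bool by (simp add: on_fst_def power2_eq_square algebra_simps)
  then show ?thesis
    using U by (simp add: SU_def on_fst_adjoint on_fst_mult on_fst_one)
qed

lemma on_snd_SU: "U \<in> SU \<Longrightarrow> on_snd U \<in> SU"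
proof -
  assume U: "U \<in> SU"
  have "det (on_snd U) = det U ^ 2"
    unfolding det_bool_pair det_bool by (simp add: on_snd_def power2_eq_square algebra_simps)
  then show ?thesis
    using U by (simp add: SU_def on_snd_adjoint on_snd_mult on_snd_one)
qed

section \<open>The preparation gates belong to SU(4)\<close>

text \<open>The gate rotates by \<open>pi / 4\<close> in the plane spanned by 00 and 11 and in the
  plane spanned by 01 and 10.\<close>

lemma prep_Phi_plus_SU: "prep_Phi_plus \<in> SU"
proof -
  define s :: complex where "s = of_real (1 / sqrt 2)"
  have "s * s = of_real ((1 / sqrt 2) * (1 / sqrt 2))"
    unfolding s_def of_real_mult ..
  then have ss: "s * s = 1 / 2"
    by simp
  have s4: "s * (s * (s * s)) = 1 / 4"
    unfolding ss by (simp add: mult.assoc[symmetric] ss)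
  have cs: "cnj s = s"
    by (simp add: s_def)
  \<comment> \<open>Off the diagonal, only the index with both bits flipped has a nonzero entry,
    negative in the columns 10 and 11.\<close>
  have P: "prep_Phi_plus = (\<chi> i j.
      if i = j then s else if fst i = fst j \<or> snd i = snd j then 0
      else if fst j \<and> (fst i \<longrightarrow> snd i) then - s else s)"
    by (auto simp: vec_eq_iff prep_Phi_plus_def outer_def ket_def Phi_plus_def Psi_plus_def
        Phi_minus_def Psi_minus_def axis_def scaleR_conv_of_real[where 'a = complex] s_def)
  have "prep_Phi_plus ** map_matrix cnj (transpose prep_Phi_plus) = mat 1"
    by (simp add: P vec_eq_iff matrix_matrix_mult_def map_matrix_def transpose_def mat_def
        sum_bool_pair cs ss)
  moreover have "det prep_Phi_plus = 1"
    unfolding det_bool_pair by (simp add: P s4 mult.assoc)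
  ultimately show ?thesis
    by (simp add: SU_def)
qed

text \<open>\<open>CNOT\<close> swaps two basis vectors, so its determinant is -1; the phase
  \<open>c\<close> multiplies it by the fourth power of \<open>c\<close>, which is -1 as
  well.\<close>

lemma CNOT_SU_SU: "CNOT_SU \<in> SU"
proof -
  define c where "c = cis (pi / 4)"
  have "c * c = \<i>"
    by (simp add: c_def cis_mult)
  then have c4: "c * (c * (c * c)) = - 1"
    by (simp add: mult.assoc[symmetric])
  have cc: "c * cnj c = 1"
    by (simp add: c_def complex_norm_square[symmetric])
  have "CNOT_SU ** map_matrix cnj (transpose CNOT_SU) = mat 1"
    by (simp add: CNOT_SU_def CNOT_def vec_eq_iff matrix_matrix_mult_def map_matrix_def
        transpose_def mat_def sum_bool_pair c_def[symmetric] cc)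
  moreover have "det CNOT_SU = 1"
    unfolding det_bool_pair by (simp add: CNOT_SU_def CNOT_def c_def[symmetric] c4 mult.assoc)
  ultimately show ?thesis
    by (simp add: SU_def)
qed

section \<open>Absorbing one-qubit gates\<close>

text \<open>Multiplying the matrix of \<open>h\<close> on the right by \<open>V\<close>, or by its
  Kronecker extension, performs \<open>V\<close> first.\<close>

lemma absorb_One_gate:
  assumes "gate_ok h" "V \<in> SU" "q \<in> set (gate_qubits h)"
  obtains h' where "gate_ok h'" "gate_qubits h' = gate_qubits h"
    "\<And>\<psi>. apply_gate h' \<psi> = apply_gate h (apply_gate (One V q) \<psi>)"
proof (cases h)
  case (One U p)
  then show ?thesis
    using assms that[of "One (U ** V) q"]
    by (simp del: apply_gate.simps add: apply_gate_One_One SU_mult)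
next
  case (Two U p r)
  show ?thesis
  proof (cases "q = p")
    case True
    then show ?thesis
      using assms Two that[of "Two (U ** on_fst V) p r"]
      by (simp del: apply_gate.simps add: apply_gate_Two_One_fst SU_mult on_fst_SU)
  next
    case False
    then show ?thesis
      using assms Two that[of "Two (U ** on_snd V) p r"]
      by (simp del: apply_gate.simps add: apply_gate_Two_One_snd SU_mult on_snd_SU)
  qed
qed

text \<open>\<open>V\<close> moves past gates that avoid \<open>q\<close> until the first gate on
  \<open>q\<close> absorbs it. Keeping every list of qubits makes disjointness and support carry
  over to \<open>M'\<close>.\<close>

lemma absorb_One_layer:
  assumes "\<forall>h\<in>set M. gate_ok h" "V \<in> SU" "q \<in> set (concat (map gate_qubits M))"
  shows "\<exists>M'. (\<forall>h\<in>set M'. gate_ok h) \<and> map gate_qubits M' = map gate_qubits M \<and>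
    (\<forall>\<psi>. fold apply_gate M' \<psi> = fold apply_gate M (apply_gate (One V q) \<psi>))"
  using assms
proof (induction M)
  case (Cons h M)
  show ?case
  proof (cases "q \<in> set (gate_qubits h)")
    case True
    with Cons.prems obtain h' where "gate_ok h'" "gate_qubits h' = gate_qubits h"
      "\<And>\<psi>. apply_gate h' \<psi> = apply_gate h (apply_gate (One V q) \<psi>)"
      using absorb_One_gate[of h V q] by auto
    with Cons.prems show ?thesis
      by (intro exI[of _ "h' # M"]) (simp del: apply_gate.simps)
  next
    case False
    with Cons obtain M' where "\<forall>h\<in>set M'. gate_ok h" "map gate_qubits M' = map gate_qubits M"
      "\<forall>\<psi>. fold apply_gate M' \<psi> = fold apply_gate M (apply_gate (One V q) \<psi>)"
      by auto
    with Cons.prems False show ?thesis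
      by (intro exI[of _ "h # M'"]) (simp del: apply_gate.simps add: apply_gate_commute)
  qed
qed simp

section \<open>Merging a gate sequence into one layer\<close>

text \<open>Lists are in time order. This is the property that permits the collapse: a two-qubit
  gate has no later gate on its qubits, so only one-qubit gates ever have to be absorbed.\<close>

fun Two_gates_final :: "gate list \<Rightarrow> bool" where
  "Two_gates_final [] \<longleftrightarrow> True"
| "Two_gates_final (h # hs) \<longleftrightarrow>
     (is_One h \<or> set (gate_qubits h) \<inter> set (concat (map gate_qubits hs)) = {}) \<and>
     Two_gates_final hs"

lemma Two_gates_final_append_One:
  "\<forall>h\<in>set gs. is_One h \<Longrightarrow> Two_gates_final (gs @ hs) \<longleftrightarrow> Two_gates_final hs"
  by (induction gs) auto

text \<open>The later gates are merged first; the earliest gate \<open>g\<close> is then placed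
  beside the layer \<open>M\<close> if disjoint from it, and absorbed by \<open>M\<close>
  otherwise.\<close>

lemma merge_into_layer:
  assumes "\<forall>h\<in>set gs. gate_ok h" "Two_gates_final gs"
  shows "\<exists>M. (\<forall>h\<in>set M. gate_ok h) \<and> distinct (concat (map gate_qubits M)) \<and>
    set (concat (map gate_qubits M)) \<subseteq> set (concat (map gate_qubits gs)) \<and>
    (\<forall>\<psi>. fold apply_gate M \<psi> = fold apply_gate gs \<psi>)"
  using assms
proof (induction gs)
  case (Cons g gs)
  then obtain M where M: "\<forall>h\<in>set M. gate_ok h" "distinct (concat (map gate_qubits M))"
    "set (concat (map gate_qubits M)) \<subseteq> set (concat (map gate_qubits gs))"
    "\<forall>\<psi>. fold apply_gate M \<psi> = fold apply_gate gs \<psi>"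
    by auto
  show ?case
  proof (cases "set (gate_qubits g) \<inter> set (concat (map gate_qubits M)) = {}")
    case True
    have "distinct (gate_qubits g)"
      using Cons.prems by (cases g) auto
    with M True Cons.prems show ?thesis
      by (intro exI[of _ "g # M"]) (auto simp del: apply_gate.simps)
  next
    case False
    \<comment> \<open>\<open>M\<close> acts only on qubits of \<open>gs\<close>, so \<open>g\<close>
      meets a later gate, which \<open>Two_gates_final\<close> allows only for a one-qubit
      gate.\<close>
    with M(3) have "set (gate_qubits g) \<inter> set (concat (map gate_qubits gs)) \<noteq> {}"
      by blast
    with Cons.prems have "is_One g"
      by auto
    then obtain V q where g: "g = One V q"
      by (cases g) auto
    with False Cons.prems have "V \<in> SU" "q \<in> set (concat (map gate_qubits M))"
      by auto
    from absorb_One_layer[OF M(1) this] obtain M' where M': "\<forall>h\<in>set M'. gate_ok h"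
      "map gate_qubits M' = map gate_qubits M"
      "\<forall>\<psi>. fold apply_gate M' \<psi> = fold apply_gate M (apply_gate (One V q) \<psi>)"
      by blast
    show ?thesis
      using M M'(1,3) by (intro exI[of _ M'], unfold M'(2)) (auto simp: g simp del: apply_gate.simps)
  qed
qed (auto intro: exI[of _ "[]"])

lemma fold_fold_concat: "fold (fold f) xss = fold f (concat xss)"
  by (induction xss) (auto simp: fun_eq_iff)

lemma layers_qubits_concat: "layers_qubits Ls = set (concat (map gate_qubits (concat Ls)))"
  by (auto simp: layers_qubits_def)

section \<open>Composition of the stages\<close>

text \<open>Later stages act inside \<open>Q (Suc i)\<close>, away from the qubits measured in stage
  \<open>i\<close>, so the two-qubit gates closing stage \<open>i\<close> are final there. Since
  this concerns later gates, the induction runs down from stage \<open>R\<close>.\<close>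

lemma composed_stages:
  fixes S :: "nat \<Rightarrow> stage" and Q :: "nat \<Rightarrow> nat set"
  assumes wf: "\<And>i. i \<le> R \<Longrightarrow> wf_stage (Q i) (S i)"
    and Q: "\<And>i. i < R \<Longrightarrow> Q (Suc i) = Q i - set (meas (S i))"
    and bell: "\<And>i. i < R \<Longrightarrow> \<exists>Ls U p p' r r'.
        layers (S i) = Ls @ [[Two U p p', Two U r r']] \<and> meas (S i) = [p, p', r, r'] \<and>
        (\<forall>L\<in>set Ls. \<forall>h\<in>set L. is_One h)"
    and last: "\<And>L h. L \<in> set (layers (S R)) \<Longrightarrow> h \<in> set L \<Longrightarrow> is_One h"
    and "i \<le> R"
  defines "gates \<equiv> \<lambda>i. concat (concat (map (layers \<circ> S) [i..<Suc R]))"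
    and "ms \<equiv> \<lambda>i. concat (map (meas \<circ> S) [i..<Suc R])"
  shows "(\<forall>h\<in>set (gates i). gate_ok h) \<and> Two_gates_final (gates i) \<and>
    set (concat (map gate_qubits (gates i))) \<subseteq> Q i \<and> distinct (ms i) \<and> set (ms i) \<subseteq> Q i"
  using \<open>i \<le> R\<close>
proof (induction i rule: inc_induct)
  case base
  \<comment> \<open>The empty list is appended to match
    \<open>Two_gates_final_append_One\<close>.\<close>
  have "Two_gates_final (concat (layers (S R)) @ [])"
    using last by (subst Two_gates_final_append_One) auto
  with wf[of R] show ?case
    by (auto simp: gates_def ms_def wf_stage_def layers_qubits_concat)
next
  case (step i)
  obtain Ls U p p' r r' where S: "layers (S i) = Ls @ [[Two U p p', Two U r r']]"
    "meas (S i) = [p, p', r, r']" "\<forall>L\<in>set Ls. \<forall>h\<in>set L. is_One h"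
    using bell[OF step.hyps(2)] by blast
  have gates: "gates i = concat (layers (S i)) @ gates (Suc i)"
    and ms: "ms i = meas (S i) @ ms (Suc i)"
    using step.hyps(2) by (simp_all add: gates_def ms_def upt_rec[of i])
  have wfi: "wf_stage (Q i) (S i)"
    using wf step.hyps by simp
  \<comment> \<open>This separates the two closing gates from each other; the next fact separates
    both from all later stages.\<close>
  have "distinct [p, p', r, r']"
    using wfi S(2) by (simp add: wf_stage_def)
  moreover have "{p, p', r, r'} \<inter> set (concat (map gate_qubits (gates (Suc i)))) = {}"
    using step.IH Q[OF step.hyps(2)] S(2) by auto
  ultimately have "Two_gates_final ([Two U p p', Two U r r'] @ gates (Suc i))"
    using step.IH by simp
  then have "Two_gates_final (gates i)"
    using S(3) by (simp add: gates S(1) Two_gates_final_append_One)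
  then show ?case
    using step.IH Q[OF step.hyps(2)] wfi
    by (auto simp: gates ms wf_stage_def layers_qubits_concat)
qed

section \<open>Initial state and preparation layers\<close>

lemma is_state_zero_state: "is_state w zero_state"
proof -
  have "finite (basis w)"
  proof (rule finite_subset)
    \<comment> \<open>A basis state is the indicator function of a set of labels below
      \<open>w\<close>. Finiteness matters because a sum over an infinite set is 0 by
      default.\<close>
    show "basis w \<subseteq> (\<lambda>A q. q \<in> A) ` Pow {..<w}"
    proof
      fix x
      assume "x \<in> basis w"
      then show "x \<in> (\<lambda>A q. q \<in> A) ` Pow {..<w}"
        by (intro image_eqI[of _ _ "{q. x q}"]) (auto simp: basis_def)
    qed
  qed simp
  moreover have "(\<lambda>_. False) \<in> basis w"
    by (simp add: basis_def)
  moreover have "(cmod (zero_state x))\<^sup>2 = (if x = (\<lambda>_. False) then 1 else 0)" for x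
    by (simp add: zero_state_def)
  ultimately show ?thesis
    by (auto simp: is_state_def) (auto simp: zero_state_def)
qed

text \<open>In each block the first layer uses two disjoint pairs and the second the middle pair;
  blocks share no labels, so all are prepared in parallel.\<close>

lemma prep_layers_ok:
  assumes "distinct (concat (map block_qubits Bs))"
  shows "\<forall>L\<in>set (prep_layers Bs). (\<forall>h\<in>set L. gate_ok h) \<and> distinct (concat (map gate_qubits L))"
    and "layers_qubits (prep_layers Bs) \<subseteq> set (concat (map block_qubits Bs))"
proof -
  show 2: "layers_qubits (prep_layers Bs) \<subseteq> set (concat (map block_qubits Bs))"
    by (force simp: prep_layers_def layers_qubits_def)
  show "\<forall>L\<in>set (prep_layers Bs). (\<forall>h\<in>set L. gate_ok h) \<and> distinct (concat (map gate_qubits L))"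
    using assms
  proof (induction Bs)
    case (Cons B Bs)
    obtain q1 q2 q3 q4 where B: "B = (q1, q2, q3, q4)"
      by (cases B)
    from Cons show ?case
      by (fastforce simp: B prep_layers_def prep_Phi_plus_SU CNOT_SU_SU)
  qed (simp add: prep_layers_def)
qed

section \<open>Collapse to depth four\<close>

theorem lemma1:
  assumes "N \<in> GC_nad"
  shows "init N = zero_state \<and> has_depth_at_most 4 N"
proof -
  obtain G B x g where G: "G \<in> QC_ad" "GC_blocks G B" and g: "guess G x g"
    and N: "N = GC_nad_circuit G B x g"
    using assms by (auto simp: GC_nad_def GC_nad_of_def GC_ad_def)
  define R where "R = rounds G x"
  \<comment> \<open>The guess selects the \<open>R + 1\<close> stages \<open>S 0\<close> to
    \<open>S R\<close>; \<open>Q i\<close> holds the qubits still present when \<open>S i\<close>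
    starts.\<close>
  define S where "S i = stage_at G x (take i g)" for i
  define Q where "Q i = unmeasured G x (take i g)" for i
  have len: "length g = R"
    using g by (simp add: guess_def R_def)
  \<comment> \<open>For \<open>i\<close> beyond \<open>R\<close> the prefix is \<open>g\<close>
    itself, so this holds for every \<open>i\<close>.\<close>
  have hist: "history G x (take i g)" for i
    using g by (auto simp: guess_def history_def)
  have wf_S: "wf_stage (Q i) (S i)" for i
    using G(1) hist[of i] by (simp add: QC_ad_def Q_def S_def)
  have Q: "Q (Suc i) = Q i - set (meas (S i))" if "i < R" for i
    using that by (auto simp: Q_def S_def unmeasured_def len less_Suc_eq)
  have bell: "\<exists>Ls U p p' r r'.
      layers (S i) = Ls @ [[Two U p p', Two U r r']] \<and> meas (S i) = [p, p', r, r'] \<and>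
      (\<forall>L\<in>set Ls. \<forall>h\<in>set L. is_One h)" if "i < R" for i
  proof -
    have "bell_stage G (B x) x (take i g)"
      using G(2) hist that len by (simp add: GC_blocks_def R_def)
    then show ?thesis
      unfolding bell_stage_def S_def by (elim exE conjE) (intro exI conjI; assumption)
  qed
  have last_One: "is_One h" if "L \<in> set (layers (S R))" "h \<in> set L" for L h
    using G(2) hist[of R] that len by (simp add: GC_blocks_def R_def S_def)
  define gates where "gates = concat (concat (map (layers \<circ> S) [0..<Suc R]))"
  \<comment> \<open>The case \<open>i = 0\<close>: nothing has been measured, so \<open>Q 0\<close>
    is the whole register.\<close>
  have stages: "\<forall>h\<in>set gates. gate_ok h" "Two_gates_final gates"
    "set (concat (map gate_qubits gates)) \<subseteq> {..<awidth G x}"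
    "distinct (concat (map (meas \<circ> S) [0..<Suc R]))"
    "set (concat (map (meas \<circ> S) [0..<Suc R])) \<subseteq> {..<awidth G x}"
    using composed_stages[of R Q S 0, OF wf_S Q bell last_One]
    by (simp_all add: gates_def Q_def unmeasured_def del: upt_Suc)
  obtain M where M: "\<forall>h\<in>set M. gate_ok h" "distinct (concat (map gate_qubits M))"
    "set (concat (map gate_qubits M)) \<subseteq> set (concat (map gate_qubits gates))"
    "\<forall>\<psi>. fold apply_gate M \<psi> = fold apply_gate gates \<psi>"
    using merge_into_layer[OF stages(1,2)] by blast
  have N_simps: "layers N = prep_layers (B x) @ concat (map (layers \<circ> S) [0..<Suc R])"
    "meas N = concat (map (meas \<circ> S) [0..<Suc R])" "width N = awidth G x" "init N = zero_state"
    by (simp_all add: N GC_nad_circuit_def QC_nad_def Let_def S_def R_def comp_def)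
  define C where "C = N\<lparr>layers := prep_layers (B x) @ [M]\<rparr>"
  have blocks: "distinct (concat (map block_qubits (B x)))"
    "set (concat (map block_qubits (B x))) \<subseteq> {..<awidth G x}"
    using G(2) by (simp_all add: GC_blocks_def)
  have "layers_qubits (layers C) =
      layers_qubits (prep_layers (B x)) \<union> set (concat (map gate_qubits M))"
    by (auto simp: C_def layers_qubits_def)
  then have "layers_qubits (layers C) \<subseteq> {..<awidth G x}"
    using order_trans[OF prep_layers_ok(2)[OF blocks(1)] blocks(2)] order_trans[OF M(3) stages(3)]
    by simp
  then have "wf_circuit C"
    using prep_layers_ok(1)[OF blocks(1)] M(1,2) stages(4,5)
    by (simp add: wf_circuit_def wf_stage_def C_def N_simps is_state_zero_state del: upt_Suc)
  \<comment> \<open>Two preparation layers, the layer \<open>M\<close> and the measurement, which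
    \<open>depth\<close> counts as a time step.\<close>
  moreover have "depth C \<le> 4"
    by (simp add: depth_def C_def prep_layers_def)
  \<comment> \<open>Only the concatenated gate sequence affects the final state, and
    \<open>M\<close> acts as \<open>gates\<close> on every state. The outputs then agree with phase
    1.\<close>
  moreover have "premeasurement C = premeasurement N"
    using M(4) by (simp add: premeasurement_def C_def N_simps fold_fold_concat gates_def del: upt_Suc)
  then have "same_output C N"
    by (auto simp: same_output_def outcome_prob_def post_state_def C_def intro!: exI[of _ 1])
  moreover have "init C = init N"
    by (simp add: C_def)
  ultimately show ?thesis
    using N_simps(4) by (auto simp: has_depth_at_most_def)
qed

end
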